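(* (i) Let $C$ be a positive integer. Then for all sufficiently large integers $k$ (depending only on $C$), setting $m=2k-1$, $b=\frac{k-C}{2k^2-k}$ and $a=1-(2k-1)b$, the system $[1/2_s: a,b,\ldots,b]$ with one player of weight $a$ and $m$ players of weight $b$ is a non-trivial Shapley-Shubik fixed point. (ii) Moreover, all non-trivial fixed points are of this form: if $k$ is a positive integer, $m=2k-1$, and $[1/2_s: a,b,\ldots,b]$ (one player of weight $a$ and $m$ players of weight $b$) is a primitive non-trivial Shapley-Shubik fixed point, then there is a positive integer $C$ such that $b=\frac{k-C}{2k^2-k}$ and $a=1-(2k-1)b$.
   Context: For real numbers $a_1,\ldots,a_N\ge 0$ with sum $1$, $V=[1/2_s: a_1,\ldots,a_N]$ denotes the weighted voting system with $N$ players, player $i$ having weight $a_i$, in which a coalition (set of players) is winning if and only if the sum of the weights of its members strictly exceeds $1/2$. Shapley-Shubik power index: for each of the $N!$ orderings of the players, the pivotal player is the one whose weight, when weights are added up from the beginning of the ordering, first makes the partial sum strictly exceed $1/2$. The Shapley-Shubik index of a player is the number of orderings in which it is pivotal divided by $N!$. Let $SS(V)$ be the tuple of Shapley-Shubik indices of players $1,\ldots,N$. $V$ is a Shapley-Shubik fixed point if $SS(V)=(a_1,\ldots,a_N)$. A fixed point is primitive if no player $i$ has $a_i=0$. A fixed point is non-trivial if not all players have the same power. *)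

theory Defs
  imports Complex_Main "HOL-Combinatorics.Multiset_Permutations"
begin

text \<open>
  The system $[1/2_s: a_1,\ldots,a_N]$ is represented by the list of its weights;
  the players are the indices $0,\ldots,N-1$ of that list.
\<close>

definition voting_system :: "real list \<Rightarrow> bool" where
  "voting_system w \<longleftrightarrow> (\<forall>i<length w. w ! i \<ge> 0) \<and> sum_list w = 1"

definition players :: "real list \<Rightarrow> nat set" where
  "players w = {..<length w}"

definition winning :: "real list \<Rightarrow> nat set \<Rightarrow> bool" where
  "winning w S \<longleftrightarrow> (\<Sum>i\<in>S. w ! i) > 1/2"

definition orderings :: "real list \<Rightarrow> nat list set" where
  "orderings w = permutations_of_set (players w)"

definition pivotal :: "real list \<Rightarrow> nat list \<Rightarrow> nat \<Rightarrow> bool" where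
  "pivotal w xs i \<longleftrightarrow> (\<exists>j<length xs. xs ! j = i \<and> winning w (set (take (Suc j) xs)) \<and>
     (\<forall>l\<le>j. \<not> winning w (set (take l xs))))"

definition SS_index :: "real list \<Rightarrow> nat \<Rightarrow> real" where
  "SS_index w i = real (card {xs \<in> orderings w. pivotal w xs i}) / fact (length w)"

definition SS :: "real list \<Rightarrow> real list" where
  "SS w = map (SS_index w) [0..<length w]"

definition SS_fixed_point :: "real list \<Rightarrow> bool" where
  "SS_fixed_point w \<longleftrightarrow> voting_system w \<and> SS w = w"

definition primitive :: "real list \<Rightarrow> bool" where
  "primitive w \<longleftrightarrow> (\<forall>i\<in>players w. w ! i \<noteq> 0)"

definition nontrivial :: "real list \<Rightarrow> bool" where
  "nontrivial w \<longleftrightarrow> \<not> (\<forall>i\<in>players w. \<forall>j\<in>players w. SS_index w i = SS_index w j)"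

end

theory Submission
  imports Defs
begin

text \<open>
  A single player of weight \<open>a\<close> facing \<open>m = 2 * k - 1\<close> players of weight \<open>b\<close> occupies each of the
  \<open>2 * k\<close> places of the ordering equally often, so its index is \<open>t / (2 * k)\<close>, where \<open>t\<close> counts the
  \<open>p \<le> m\<close> with \<open>p * b \<le> 1/2 < p * b + a\<close>. The remaining power is shared equally by the other players,
  hence the fixed points are given by \<open>a = t / (2 * k)\<close>. If \<open>t = 2 * C\<close>, this is the stated form of
  the weights; an odd \<open>t\<close> can only come from a coalition of weight exactly 1/2.
\<close>

section \<open>Existence and uniqueness of the pivot; total power\<close>

text \<open>If one pivot stood at an earlier place j than the other, at j', then the prefix of
  length \<open>Suc j\<close> would be winning for the first and, since \<open>Suc j\<close> is at
  most j', losing for the second.\<close>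

lemma pivotal_unique:
  assumes "pivotal w xs i" "pivotal w xs i'"
  shows "i = i'"
proof -
  obtain j where j: "xs ! j = i" "winning w (set (take (Suc j) xs))"
    "\<forall>l\<le>j. \<not> winning w (set (take l xs))"
    using assms(1) unfolding pivotal_def by blast
  obtain j' where j': "xs ! j' = i'" "winning w (set (take (Suc j') xs))"
    "\<forall>l\<le>j'. \<not> winning w (set (take l xs))"
    using assms(2) unfolding pivotal_def by blast
  have "j = j'"
    using j(2,3) j'(2,3) by (metis not_less_eq_eq order_antisym)
  with j(1) j'(1) show ?thesis by simp
qed

lemma pivotal_exists:
  assumes "winning w (set xs)"
  shows "\<exists>i\<in>set xs. pivotal w xs i"
proof -
  define n where "n = (LEAST l. winning w (set (take l xs)))"
  let ?P = "\<lambda>l. winning w (set (take l xs))"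
  have ex: "?P (length xs)"
    using assms by simp
  have n: "winning w (set (take n xs))" and le: "n \<le> length xs"
    unfolding n_def using LeastI[of ?P, OF ex] Least_le[of ?P, OF ex] by blast+
  have less: "\<not> winning w (set (take l xs))" if "l < n" for l
    using that not_less_Least unfolding n_def by blast
  \<comment> \<open>The empty coalition has weight 0 and loses, so the shortest winning prefix has a
    last player; that player is the pivot.\<close>
  have "n \<noteq> 0"
    using n by (auto simp: winning_def intro!: Nat.gr0I)
  then obtain j where j: "n = Suc j"
    using not0_implies_Suc by blast
  have "pivotal w xs (xs ! j)"
    unfolding pivotal_def using n le less j by (intro exI[of _ j]) auto
  moreover have "xs ! j \<in> set xs"
    using le j by simp
  ultimately show ?thesis by blast
qed

lemma finite_orderings: "finite (orderings w)"
  by (simp add: orderings_def players_def)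

lemma card_orderings: "card (orderings w) = fact (length w)"
  by (simp add: orderings_def players_def)

text \<open>The grand coalition has weight 1 and wins, so every ordering has exactly one pivot, and
  sorting the orderings by pivot partitions them.\<close>

lemma sum_SS_index:
  assumes "voting_system w"
  shows "(\<Sum>i<length w. SS_index w i) = 1"
proof -
  have "winning w (set xs) \<and> set xs = {..<length w}" if "xs \<in> orderings w" for xs
  proof -
    have "set xs = {..<length w}"
      using that by (simp add: orderings_def players_def permutations_of_set_def)
    moreover have "(\<Sum>i<length w. w ! i) = 1"
      using assms by (simp add: voting_system_def sum_list_sum_nth atLeast0LessThan)
    ultimately show ?thesis by (simp add: winning_def)
  qed
  hence "\<exists>i<length w. pivotal w xs i" if "xs \<in> orderings w" for xs
    using that pivotal_exists[of w xs] by (metis lessThan_iff)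
  hence "orderings w = (\<Union>i<length w. {xs \<in> orderings w. pivotal w xs i})"
    by auto
  hence "card (orderings w) = card (\<Union>i<length w. {xs \<in> orderings w. pivotal w xs i})"
    by simp
  also have "\<dots> = (\<Sum>i<length w. card {xs \<in> orderings w. pivotal w xs i})"
    by (rule card_UN_disjoint) (auto simp: finite_orderings dest: pivotal_unique)
  finally have "(\<Sum>i<length w. card {xs \<in> orderings w. pivotal w xs i}) = fact (length w)"
    by (simp add: card_orderings)
  hence "real (\<Sum>i<length w. card {xs \<in> orderings w. pivotal w xs i}) = fact (length w)"
    by (simp only: of_nat_fact)
  thus ?thesis
    by (simp add: SS_index_def flip: sum_divide_distrib)
qed

section \<open>Equal weights have equal power\<close>

lemma winning_permute:
  assumes "inj \<sigma>" "\<And>x. w ! (\<sigma> x) = w ! x"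
  shows "winning w (\<sigma> ` S) \<longleftrightarrow> winning w S"
  by (simp add: winning_def sum.reindex inj_on_subset[OF assms(1)] assms(2))

lemma pivotal_permute:
  assumes "inj \<sigma>" "\<And>x. w ! (\<sigma> x) = w ! x"
  shows "pivotal w (map \<sigma> xs) (\<sigma> i) \<longleftrightarrow> pivotal w xs i"
  unfolding pivotal_def using assms(1)
  by (auto simp: take_map winning_permute[OF assms] inj_eq simp del: take_Suc)

text \<open>Transposing two players of equal weight changes no coalition weight, and it is an
  involution on the orderings that exchanges those with pivot \<open>i\<close> and those with pivot
  \<open>j\<close>.\<close>

lemma SS_index_cong_weight:
  assumes "i < length w" "j < length w" "w ! i = w ! j"
  shows "SS_index w i = SS_index w j"
proof -
  define \<sigma> where "\<sigma> = transpose i j"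
  have inj: "inj \<sigma>" and invol: "\<sigma> (\<sigma> x) = x" and ij: "\<sigma> i = j" "\<sigma> j = i" for x
    by (auto simp: \<sigma>_def)
  \<comment> \<open>This holds for every \<open>x\<close>, even past the end of the list: there the
    transposition fixes \<open>x\<close>, so the unspecified value is only compared with
    itself.\<close>
  have weight: "w ! (\<sigma> x) = w ! x" for x
    using assms(3) by (simp add: \<sigma>_def transpose_def)
  have "\<sigma> ` players w = players w"
    unfolding \<sigma>_def using assms(1,2) by (intro transpose_image_eq) (simp add: players_def)
  hence ord: "map \<sigma> xs \<in> orderings w" if "xs \<in> orderings w" for xs
    using that inj by (auto simp: orderings_def permutations_of_set_def distinct_map intro: inj_on_subset)
  have piv: "pivotal w (map \<sigma> xs) (\<sigma> l) \<longleftrightarrow> pivotal w xs l" for xs l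
    by (rule pivotal_permute[OF inj weight])
  have "bij_betw (map \<sigma>) {xs \<in> orderings w. pivotal w xs i} {xs \<in> orderings w. pivotal w xs j}"
    using ord piv[of _ i] piv[of _ j] ij
    by (intro bij_betw_byWitness[where f' = "map \<sigma>"]) (auto simp: invol o_def)
  thus ?thesis
    by (simp add: SS_index_def bij_betw_same_card)
qed

section \<open>The index of the single player\<close>

text \<open>Inserting \<open>x\<close> at place \<open>p\<close> is a bijection from the
  permutations of the other elements; deleting the entry at place \<open>p\<close> is its
  inverse.\<close>

lemma card_permutations_nth_eq:
  assumes "finite A" "x \<in> A" "p < card A"
  shows "card {xs \<in> permutations_of_set A. xs ! p = x} = fact (card A - 1)"
proof -
  have len: "length ys = card A - 1" if "ys \<in> permutations_of_set (A - {x})" for ys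
    using length_finite_permutations_of_set[OF that] assms by simp
  have "bij_betw (\<lambda>ys. take p ys @ x # drop p ys)
          (permutations_of_set (A - {x})) {xs \<in> permutations_of_set A. xs ! p = x}"
  proof (intro bij_betw_byWitness[where f' = "\<lambda>xs. take p xs @ drop (Suc p) xs"] ballI subsetI)
    fix ys assume ys: "ys \<in> permutations_of_set (A - {x})"
    then show "take p (take p ys @ x # drop p ys) @ drop (Suc p) (take p ys @ x # drop p ys) = ys"
      using len[OF ys] assms(3) by simp
  next
    fix xs assume "xs \<in> {xs \<in> permutations_of_set A. xs ! p = x}"
    then have xs: "p < length xs" "xs ! p = x"
      using assms(3) length_finite_permutations_of_set[of xs A] by auto
    have "take p xs @ x # drop (Suc p) xs = xs"
      using id_take_nth_drop[OF xs(1)] xs(2) by simp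
    then show "take p (take p xs @ drop (Suc p) xs) @ x # drop p (take p xs @ drop (Suc p) xs) = xs"
      using xs(1) by simp
  next
    fix zs assume "zs \<in> (\<lambda>ys. take p ys @ x # drop p ys) ` permutations_of_set (A - {x})"
    then obtain ys where ys: "ys \<in> permutations_of_set (A - {x})"
      and zs: "zs = take p ys @ x # drop p ys" by blast
    have "set (take p ys) \<union> set (drop p ys) = set ys"
      by (metis append_take_drop_id set_append)
    moreover have "set (take p ys) \<inter> set (drop p ys) = {}"
      using ys set_take_disj_set_drop_if_distinct[of ys p p] by (simp add: permutations_of_set_def)
    ultimately show "zs \<in> {xs \<in> permutations_of_set A. xs ! p = x}"
      using ys len[OF ys] assms zs
      by (auto simp: permutations_of_set_def nth_append)
  next
    fix zs assume "zs \<in> (\<lambda>xs. take p xs @ drop (Suc p) xs) ` {xs \<in> permutations_of_set A. xs ! p = x}"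
    then obtain xs where "xs \<in> permutations_of_set A" "xs ! p = x"
      and zs: "zs = take p xs @ drop (Suc p) xs" by blast
    then have xs: "set xs = A" "distinct xs" "p < length xs"
      using assms(3) length_finite_permutations_of_set[of xs A] by (auto simp: permutations_of_set_def)
    define us vs where "us = take p xs" and "vs = drop (Suc p) xs"
    have "xs = us @ x # vs"
      using id_take_nth_drop[OF xs(3)] \<open>xs ! p = x\<close> by (simp add: us_def vs_def)
    thus "zs \<in> permutations_of_set (A - {x})"
      using xs zs unfolding us_def[symmetric] vs_def[symmetric] by (auto simp: permutations_of_set_def)
  qed
  thus ?thesis
    using assms by (simp flip: bij_betw_same_card)
qed

text \<open>Player 0 at place \<open>p\<close> is preceded by \<open>p\<close> players of weight
  \<open>b\<close>, so its place alone decides whether it is pivotal. Each place occurs in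
  \<open>fact m\<close> orderings, and \<open>fact m / fact (m + 1)\<close> is 1/(m + 1).\<close>

lemma SS_index_large_player:
  fixes a b :: real
  assumes "b \<ge> 0"
  shows "SS_index (a # replicate m b) 0 =
    card {p::nat. p \<le> m \<and> p * b \<le> 1/2 \<and> p * b + a > 1/2} / (m + 1)"
proof -
  define w where "w = a # replicate m b"
  define T where "T = {p::nat. p \<le> m \<and> p * b \<le> 1/2 \<and> p * b + a > 1/2}"
  have players: "players w = {..<Suc m}"
    by (simp add: players_def w_def)
  have ord: "set xs = {..<Suc m}" "distinct xs" "length xs = Suc m" if "xs \<in> orderings w" for xs
    using that length_finite_permutations_of_set[of xs "{..<Suc m}"]
    by (auto simp: orderings_def players permutations_of_set_def)
  have piv: "pivotal w xs 0 \<longleftrightarrow> p \<in> T" if xs: "xs \<in> orderings w" "p \<le> m" "xs ! p = 0" for xs p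
  proof -
    have pos: "j = p" if "j < Suc m" "xs ! j = 0" for j
      using that xs ord[OF xs(1)] by (metis nth_eq_iff_index_eq le_imp_less_Suc)
    have small: "(\<Sum>i\<in>set (take l xs). w ! i) = l * b" if "l \<le> p" for l
    proof -
      have "w ! i = b" if i: "i \<in> set (take l xs)" for i
      proof -
        obtain j where "j < l" "j < length xs" "xs ! j = i"
          using i by (auto simp: in_set_conv_nth)
        hence "i \<noteq> 0" "i < Suc m"
          using pos[of j] \<open>l \<le> p\<close> ord[OF xs(1)] nth_mem[of j xs] by auto
        thus ?thesis by (cases i) (auto simp: w_def)
      qed
      hence "(\<Sum>i\<in>set (take l xs). w ! i) = real (card (set (take l xs))) * b"
        by simp
      thus ?thesis
        using ord[OF xs(1)] xs(2) \<open>l \<le> p\<close> by (simp add: distinct_card)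
    qed
    have "set (take (Suc p) xs) = insert 0 (set (take p xs))"
      using ord[OF xs(1)] xs(2,3) by (simp add: take_Suc_conv_app_nth)
    moreover have "0 \<notin> set (take p xs)"
    proof
      assume "0 \<in> set (take p xs)"
      then obtain j where "j < p" "xs ! j = 0"
        by (auto simp: in_set_conv_nth)
      with pos[of j] xs(2) show False by simp
    qed
    ultimately have large: "(\<Sum>i\<in>set (take (Suc p) xs). w ! i) = p * b + a"
      using small[of p] by (simp add: w_def)
    have "pivotal w xs 0 \<longleftrightarrow> p * b + a > 1/2 \<and> (\<forall>l\<le>p. l * b \<le> 1/2)"
    proof
      assume "pivotal w xs 0"
      then obtain j where j: "j < length xs" "xs ! j = 0" "winning w (set (take (Suc j) xs))"
          "\<forall>l\<le>j. \<not> winning w (set (take l xs))"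
        unfolding pivotal_def by blast
      moreover have "j = p"
        using pos j ord[OF xs(1)] by simp
      ultimately show "p * b + a > 1/2 \<and> (\<forall>l\<le>p. l * b \<le> 1/2)"
        unfolding winning_def using large small by (simp add: not_less)
    next
      assume "p * b + a > 1/2 \<and> (\<forall>l\<le>p. l * b \<le> 1/2)"
      then show "pivotal w xs 0"
        unfolding pivotal_def winning_def using ord[OF xs(1)] xs large small
        by (intro exI[of _ p]) (simp add: not_less)
    qed
    \<comment> \<open>As \<open>b\<close> is nonnegative, the longest prefix before player 0 is the
      heaviest, so only that one needs testing.\<close>
    moreover have "(\<forall>l\<le>p. l * b \<le> 1/2) \<longleftrightarrow> p * b \<le> 1/2"
      using assms by (meson mult_right_mono of_nat_mono order.refl order.trans)
    ultimately show ?thesis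
      using xs(2) by (auto simp: T_def)
  qed
  have "{xs \<in> orderings w. pivotal w xs 0} = (\<Union>p\<in>T. {xs \<in> orderings w. xs ! p = 0})"
  proof (intro equalityI subsetI)
    fix xs assume xs: "xs \<in> {xs \<in> orderings w. pivotal w xs 0}"
    then have "0 \<in> set xs" using ord by auto
    then obtain p where "p \<le> m" "xs ! p = 0"
      using ord xs by (auto simp: in_set_conv_nth less_Suc_eq_le)
    then show "xs \<in> (\<Union>p\<in>T. {xs \<in> orderings w. xs ! p = 0})"
      using piv xs by blast
  qed (use piv in \<open>auto simp: T_def\<close>)
  moreover have "card (\<Union>p\<in>T. {xs \<in> orderings w. xs ! p = 0}) =
      (\<Sum>p\<in>T. card {xs \<in> orderings w. xs ! p = 0})"
  proof (rule card_UN_disjoint)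
    show "\<forall>p\<in>T. \<forall>q\<in>T. p \<noteq> q \<longrightarrow>
        {xs \<in> orderings w. xs ! p = 0} \<inter> {xs \<in> orderings w. xs ! q = 0} = {}"
      using ord by (auto simp: T_def) (metis le_imp_less_Suc nth_eq_iff_index_eq)
  qed (auto simp: T_def finite_orderings)
  moreover have "card {xs \<in> orderings w. xs ! p = 0} = fact m" if "p \<in> T" for p
    using that card_permutations_nth_eq[of "{..<Suc m}" 0 p]
    by (simp add: orderings_def players T_def)
  ultimately have "card {xs \<in> orderings w. pivotal w xs 0} = card T * fact m"
    by simp
  thus ?thesis
    unfolding T_def[symmetric] unfolding SS_index_def w_def[symmetric]
    by (simp add: w_def)
qed

section \<open>Fixed points with one distinguished player\<close>

lemma sum_list_large_player: "sum_list (a # replicate m b) = a + m * (b::real)"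
  by (simp add: sum_list_replicate)

text \<open>By symmetry the \<open>m\<close> players of weight \<open>b\<close> share the remaining
  power 1 - a equally, which gives each of them \<open>b\<close>. Hence the single equation for
  player 0 settles the whole system.\<close>

lemma SS_fixed_point_large_playerI:
  fixes a b :: real
  assumes "a \<ge> 0" "b \<ge> 0" "a + m * b = 1" "m > 0"
    and "SS_index (a # replicate m b) 0 = a"
  shows "SS_fixed_point (a # replicate m b)"
proof -
  define w where "w = a # replicate m b"
  have len: "length w = Suc m" and nth: "w ! 0 = a" "\<And>i. i < m \<Longrightarrow> w ! Suc i = b"
    by (auto simp: w_def)
  have vs: "voting_system w"
    using assms nth sum_list_large_player[of a m b]
    by (auto simp: voting_system_def len w_def less_Suc_eq_0_disj)
  have eq: "SS_index w (Suc i) = SS_index w (Suc 0)" if "i < m" for i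
    using that \<open>m > 0\<close> by (intro SS_index_cong_weight) (auto simp: len nth)
  have "1 = SS_index w 0 + (\<Sum>i<m. SS_index w (Suc i))"
    using sum_SS_index[OF vs] by (simp add: len sum.lessThan_Suc_shift del: sum.lessThan_Suc)
  also have "(\<Sum>i<m. SS_index w (Suc i)) = (\<Sum>i<m. SS_index w (Suc 0))"
    by (intro sum.cong refl eq) simp
  also have "\<dots> = m * SS_index w (Suc 0)"
    by simp
  finally have "m * SS_index w (Suc 0) = m * b"
    using assms(3,5) unfolding w_def by linarith
  hence "SS_index w (Suc i) = b" if "i < m" for i
    using \<open>m > 0\<close> eq[OF that] by simp
  hence "SS w = w"
    using assms(5) nth
    by (intro nth_equalityI) (auto simp: SS_def len less_Suc_eq_0_disj simp flip: w_def simp del: upt_Suc)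
  with vs show ?thesis
    by (simp add: SS_fixed_point_def w_def)
qed

lemma SS_fixed_point_index:
  assumes "SS_fixed_point w" "i < length w"
  shows "SS_index w i = w ! i"
proof -
  have "SS w ! i = w ! i" using assms by (simp add: SS_fixed_point_def)
  thus ?thesis using assms(2) by (simp add: SS_def)
qed

lemma SS_fixed_point_large_playerD:
  fixes a b :: real
  assumes "SS_fixed_point (a # replicate m b)" "m > 0"
  shows "a \<ge> 0" "b \<ge> 0" "a + m * b = 1" "SS_index (a # replicate m b) 0 = a"
proof -
  let ?w = "a # replicate m b"
  have vs: "voting_system ?w"
    using assms(1) by (simp add: SS_fixed_point_def)
  show "a \<ge> 0" "b \<ge> 0"
    using vs \<open>m > 0\<close> by (auto simp: voting_system_def dest: spec[of _ 0] spec[of _ 1])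
  show "a + m * b = 1"
    using vs unfolding voting_system_def sum_list_large_player by blast
  show "SS_index ?w 0 = a"
    using SS_fixed_point_index[OF assms(1), of 0] by simp
qed

text \<open>At a fixed point power and weight coincide, so comparing powers means comparing
  weights.\<close>

lemma nontrivial_large_player_iff:
  assumes "SS_fixed_point (a # replicate m b)" "m > 0"
  shows "nontrivial (a # replicate m b) \<longleftrightarrow> a \<noteq> b"
proof -
  let ?w = "a # replicate m b"
  have "nontrivial ?w \<longleftrightarrow> (\<exists>i<Suc m. \<exists>j<Suc m. ?w ! i \<noteq> ?w ! j)"
    using SS_fixed_point_index[OF assms(1)] by (auto simp: nontrivial_def players_def)
  also have "\<dots> \<longleftrightarrow> a \<noteq> b"
  proof
    assume "a \<noteq> b"
    then show "\<exists>i<Suc m. \<exists>j<Suc m. ?w ! i \<noteq> ?w ! j"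
      using assms(2) by (intro exI[of _ 0] conjI exI[of _ 1]) auto
  qed (auto simp: less_Suc_eq_0_disj)
  finally show ?thesis .
qed

section \<open>The explicit family\<close>

text \<open>Everything follows from (k + C - 1) b < 1/2 < (k + C) b. This bounds \<open>p\<close>
  from above; since the weights add up to 1, the second condition says that 2k - 1 - p obeys the
  same bound, which makes the interval symmetric.\<close>

lemma swings_large_player_explicit:
  fixes k C :: nat and b :: real
  defines "b \<equiv> (real k - real C) / (2 * (real k)\<^sup>2 - real k)"
  assumes "C > 0" "k > 2 * C\<^sup>2"
  shows "{p::nat. p \<le> 2 * k - 1 \<and> p * b \<le> 1/2 \<and> p * b + (1 - (2 * real k - 1) * b) > 1/2} =
    {k - C..<k + C}"
proof -
  have Ck: "C < k"
    using le_square[of C] assms unfolding power2_eq_square by linarith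
  define D where "D = 2 * (real k)\<^sup>2 - real k"
  have "real k * (2 * real k - 1) > 0" using Ck by (intro mult_pos_pos) auto
  hence D: "D > 0" by (simp add: D_def power2_eq_square algebra_simps)
  have bD: "b * D = real k - real C" using D by (simp add: b_def D_def)
  have b: "b > 0" using Ck D by (simp add: b_def D_def)
  have k: "real k > 2 * (real C)\<^sup>2"
    using assms(3) of_nat_less_iff[of "2 * C\<^sup>2" k, where 'a = real] by simp
  have C1: "real C \<le> (real C)\<^sup>2"
    using assms(2) by (simp add: power2_eq_square)
  \<comment> \<open>The right side is k^2 - C^2 and the left side k^2 - k/2, so this inequality is
    exactly k > 2 C^2.\<close>
  have "1/2 * D < ((real k + real C) * b) * D"
    using k unfolding mult.assoc bD by (simp add: D_def power2_eq_square algebra_simps)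
  hence upper: "(real k + real C) * b > 1/2"
    by (rule mult_right_less_imp_less) (use D in simp)
  \<comment> \<open>After expansion this reads C - C^2 < k/2, where the left side is at most
    0.\<close>
  have "((real k + real C - 1) * b) * D < 1/2 * D"
    using C1 Ck unfolding mult.assoc bD by (simp add: D_def power2_eq_square algebra_simps)
  hence lower: "(real k + real C - 1) * b < 1/2"
    by (rule mult_right_less_imp_less) (use D in simp)
  have le_iff: "real p * b \<le> 1/2 \<longleftrightarrow> p < k + C" for p
  proof
    assume "real p * b \<le> 1/2"
    with upper have "real p * b < (real k + real C) * b" by linarith
    hence "real p < real k + real C" using b by simp
    thus "p < k + C" by linarith
  next
    assume "p < k + C"
    hence "real p \<le> real k + real C - 1" by linarith
    hence "real p * b \<le> (real k + real C - 1) * b" using b by simp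
    with lower show "real p * b \<le> 1/2" by linarith
  qed
  have gr_iff: "real p * b + (1 - (2 * real k - 1) * b) > 1/2 \<longleftrightarrow> k - C \<le> p" for p
  proof
    assume "real p * b + (1 - (2 * real k - 1) * b) > 1/2"
    with upper have "(2 * real k - 1 - real p) * b < (real k + real C) * b"
      by (simp add: algebra_simps)
    hence "2 * real k - 1 - real p < real k + real C" using b by simp
    thus "k - C \<le> p" by linarith
  next
    assume "k - C \<le> p"
    hence "2 * real k - 1 - real p \<le> real k + real C - 1" by linarith
    hence "(2 * real k - 1 - real p) * b \<le> (real k + real C - 1) * b" using b by simp
    with lower show "real p * b + (1 - (2 * real k - 1) * b) > 1/2"
      by (simp add: algebra_simps)
  qed
  show ?thesis
    unfolding le_iff gr_iff using Ck by auto
qed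

lemma fixed_point_large_player_explicit:
  fixes k C :: nat
  assumes "C > 0" "k > 2 * C\<^sup>2"
  defines "b \<equiv> (real k - real C) / (2 * (real k)\<^sup>2 - real k)"
  defines "a \<equiv> 1 - (2 * real k - 1) * b"
  shows "SS_fixed_point (a # replicate (2 * k - 1) b)"
    and "nontrivial (a # replicate (2 * k - 1) b)"
proof -
  have Ck: "C < k"
    using le_square[of C] assms unfolding power2_eq_square by linarith
  have b: "b = (real k - real C) / (real k * (2 * real k - 1))"
    by (simp add: b_def power2_eq_square algebra_simps)
  have a: "a = real C / real k"
    using Ck by (simp add: a_def b field_simps)
  have b0: "b \<ge> 0"
    using Ck by (simp add: b)
  have m: "real (2 * k - 1) = 2 * real k - 1"
    using Ck by (simp add: of_nat_diff)
  have swings: "{p::nat. p \<le> 2 * k - 1 \<and> p * b \<le> 1/2 \<and> p * b + a > 1/2} = {k - C..<k + C}"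
    unfolding a_def b_def by (rule swings_large_player_explicit[OF assms(1,2)])
  have "SS_index (a # replicate (2 * k - 1) b) 0 = card {k - C..<k + C} / (2 * k)"
    unfolding SS_index_large_player[OF b0] swings m by simp
  \<comment> \<open>The interval has 2C places out of 2k, which is C/k.\<close>
  also have "\<dots> = a"
    using Ck by (simp add: a field_simps)
  finally have index: "SS_index (a # replicate (2 * k - 1) b) 0 = a" .
  have "a \<ge> 0"
    by (simp add: a)
  moreover have "a + real (2 * k - 1) * b = 1"
    unfolding m a_def by simp
  ultimately show fp: "SS_fixed_point (a # replicate (2 * k - 1) b)"
    using b0 Ck index by (intro SS_fixed_point_large_playerI) simp_all
  \<comment> \<open>With equal weights each of the 2k players would weigh 1/(2k), so 2C = 1, which
    parity excludes.\<close>
  have "a \<noteq> b"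
  proof
    assume "a = b"
    hence "2 * real k * a = 1" using a_def by (simp add: algebra_simps)
    hence "2 * real C = 1" using Ck by (simp add: a)
    hence "real (2 * C) = real 1" by simp
    hence "2 * C = 1" by (simp only: of_nat_eq_iff)
    thus False by presburger
  qed
  thus "nontrivial (a # replicate (2 * k - 1) b)"
    using nontrivial_large_player_iff[OF fp] Ck by simp
qed

section \<open>Parity and ties\<close>

text \<open>
  Without a tie at exactly 1/2, the set of swing positions is invariant under
  \<open>p \<mapsto> m - p\<close>, which has no fixed point because \<open>m\<close> is odd.
\<close>

lemma even_card_swings_large_player:
  fixes a b :: real and k m :: nat
  assumes "b > 0" "a + m * b = 1" "m = 2 * k - 1" "k > 0"
    and no_tie: "\<And>p::nat. p \<le> m \<Longrightarrow> p * b \<noteq> 1/2"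
  shows "even (card {p::nat. p \<le> m \<and> p * b \<le> 1/2 \<and> p * b + a > 1/2})"
proof -
  \<comment> \<open>\<open>f\<close> is the largest number of weight-\<open>b\<close> players that
    together do not exceed 1/2.\<close>
  define f where "f = nat \<lfloor>1 / (2 * b)\<rfloor>"
  have le_iff: "real p * b \<le> 1/2 \<longleftrightarrow> p \<le> f" for p
  proof -
    have "real p * b \<le> 1/2 \<longleftrightarrow> real p \<le> 1 / (2 * b)"
      using assms(1) by (simp add: field_simps)
    also have "\<dots> \<longleftrightarrow> p \<le> f"
      using assms(1) by (simp add: f_def le_nat_iff le_floor_iff)
    finally show ?thesis .
  qed
  have "real p * b + a > 1/2 \<longleftrightarrow> m - p \<le> f" if "p \<le> m" for p
  proof -
    \<comment> \<open>The complementary \<open>m - p\<close> players weigh 1 minus the left-hand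
      weight. The strict bound then becomes a weak one because there is no tie.\<close>
    have "real p * b + a > 1/2 \<longleftrightarrow> real (m - p) * b < 1/2"
      using assms(2) that by (simp add: of_nat_diff algebra_simps) linarith
    also have "\<dots> \<longleftrightarrow> real (m - p) * b \<le> 1/2"
      using no_tie[of "m - p"] by auto
    finally show ?thesis unfolding le_iff .
  qed
  hence "{p::nat. p \<le> m \<and> p * b \<le> 1/2 \<and> p * b + a > 1/2} = {m - f..min f m}"
    unfolding le_iff by auto
  \<comment> \<open>For f at most m the count is 2f + 1 - m, truncated at 0, and \<open>m\<close> is
    odd; for larger f it is m + 1 = 2k.\<close>
  moreover have "even (Suc (min f m) - (m - f))"
    using assms(3,4) by (cases "f \<le> m"; simp)
  ultimately show ?thesis by simp
qed

text \<open>
  A tie forces \<open>b = 1 / (2 * q)\<close> and makes the number of swing positions equal to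
  \<open>2 * q - m = 2 * q * a\<close>, so a fixed point must have \<open>q = k\<close> and equal weights.
\<close>

lemma equal_weights_if_tie:
  fixes a b :: real and k m q :: nat
  assumes "b > 0" "a > 0" "a + m * b = 1" "m = 2 * k - 1" "k > 0"
    and q: "q \<le> m" "q * b = 1/2"
    and fp: "a = card {p::nat. p \<le> m \<and> p * b \<le> 1/2 \<and> p * b + a > 1/2} / (2 * k)"
  shows "a = b"
proof -
  have le_iff: "real p * b \<le> 1/2 \<longleftrightarrow> p \<le> q" for p
    using assms(1) by (simp flip: q(2))
  have gr_iff: "real p * b + a > 1/2 \<longleftrightarrow> m < q + p" for p
  proof -
    have "real p * b + a > 1/2 \<longleftrightarrow> real m * b < (real q + real p) * b"
      using assms(3) q(2) by (simp add: algebra_simps) linarith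
    also have "\<dots> \<longleftrightarrow> m < q + p"
      using assms(1) by (simp flip: of_nat_add)
    finally show ?thesis .
  qed
  have "{p::nat. p \<le> m \<and> p * b \<le> 1/2 \<and> p * b + a > 1/2} = {Suc m - q..q}"
    using q(1) unfolding le_iff gr_iff by auto
  hence "a * (2 * k) = real (Suc q - (Suc m - q))"
    using fp assms(5) by simp
  \<comment> \<open>The right side is 1 and the left side 1 - a. The resulting
    \<open>m < 2 * q\<close> makes the truncated subtraction in the cardinality exact.\<close>
  moreover have "real m * b < real (2 * q) * b"
    using assms(2,3) q(2) by simp
  hence "m < 2 * q"
    using assms(1) by (simp only: mult_less_cancel_right_pos of_nat_less_iff)
  ultimately have "a * (2 * k) = 2 * real q - real m"
    using q(1) by (simp add: of_nat_diff)
  \<comment> \<open>Both inserted factors, a + m b and 2 q b, equal 1; the terms in \<open>b\<close>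
    then cancel.\<close>
  also have "\<dots> = 2 * real q * (a + m * b) - m * (2 * (q * b))"
    using assms(3) q(2) by simp
  also have "\<dots> = a * (2 * q)"
    by (simp add: algebra_simps)
  finally have "k = q"
    using assms(2) by simp
  hence "real m = 2 * real q - 1"
    using assms(4,5) by (simp add: of_nat_diff)
  hence "a + 2 * (q * b) - b = 1"
    using assms(3) by (simp add: left_diff_distrib)
  with q(2) show ?thesis by linarith
qed

section \<open>Existence and classification of the fixed points\<close>

theorem proposition3p1:
  shows "(\<forall>C::nat. C > 0 \<longrightarrow>
           (\<exists>K::nat. \<forall>k\<ge>K.
              let m = 2 * k - 1;
                  b = (real k - real C) / (2 * (real k)\<^sup>2 - real k);
                  a = 1 - (2 * real k - 1) * b;
                  w = a # replicate m b
              in SS_fixed_point w \<and> nontrivial w)) \<and>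
         (\<forall>(k::nat) (m::nat) (a::real) (b::real).
            k > 0 \<longrightarrow> m = 2 * k - 1 \<longrightarrow>
            SS_fixed_point (a # replicate m b) \<longrightarrow>
            primitive (a # replicate m b) \<longrightarrow>
            nontrivial (a # replicate m b) \<longrightarrow>
            (\<exists>C::nat. C > 0 \<and>
               b = (real k - real C) / (2 * (real k)\<^sup>2 - real k) \<and>
               a = 1 - (2 * real k - 1) * b))"
proof (intro conjI allI impI)
  fix C :: nat
  assume "C > 0"
  then show "\<exists>K. \<forall>k\<ge>K.
      let m = 2 * k - 1;
          b = (real k - real C) / (2 * (real k)\<^sup>2 - real k);
          a = 1 - (2 * real k - 1) * b;
          w = a # replicate m b
      in SS_fixed_point w \<and> nontrivial w"
    using fixed_point_large_player_explicit[of C]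
    \<comment> \<open>The threshold turns k at least K into k > 2 C^2.\<close>
    by (intro exI[of _ "Suc (2 * C\<^sup>2)"]) (simp add: Let_def Suc_le_eq)
next
  fix k m :: nat and a b :: real
  let ?w = "a # replicate m b"
  let ?T = "{p::nat. p \<le> m \<and> p * b \<le> 1/2 \<and> p * b + a > 1/2}"
  assume k: "k > 0" and m: "m = 2 * k - 1" and fp: "SS_fixed_point ?w"
    and prim: "primitive ?w" and "nontrivial ?w"
  have m0: "m > 0" and mr: "real m = 2 * real k - 1"
    using k m by (auto simp: of_nat_diff)
  note D = SS_fixed_point_large_playerD[OF fp m0]
  have "a \<noteq> b"
    using nontrivial_large_player_iff[OF fp m0] \<open>nontrivial ?w\<close> by blast
  have "?w ! i \<noteq> 0" if "i < Suc m" for i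
    using prim that by (simp add: primitive_def players_def)
  from this[of 0] this[of 1] have "a \<noteq> 0" "b \<noteq> 0"
    using m0 by auto
  with D m0 have "a > 0" "b > 0" by auto
  have a: "a = card ?T / (2 * k)"
    using SS_index_large_player[OF D(2), of a m] D(4) mr by simp
  \<comment> \<open>A tie would force equal weights, contradicting non-triviality.\<close>
  have "\<nexists>q::nat. q \<le> m \<and> q * b = 1/2"
    using equal_weights_if_tie[OF \<open>b > 0\<close> \<open>a > 0\<close> D(3) m k _ _ a] \<open>a \<noteq> b\<close> by blast
  hence "even (card ?T)"
    by (intro even_card_swings_large_player[OF \<open>b > 0\<close> D(3) m k]) blast
  \<comment> \<open>The sought \<open>C\<close> is half the number of swing places, so that a =
    2C/(2k).\<close>
  then obtain C where C: "card ?T = 2 * C" by (rule evenE)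
  have aC: "a = real C / real k"
    using a k unfolding C by simp
  have "C > 0"
    using aC \<open>a > 0\<close> by (auto intro!: Nat.gr0I)
  moreover have "b = (real k - real C) / (2 * (real k)\<^sup>2 - real k)"
  proof -
    have "real k * ((2 * real k - 1) * b) = real k - real C"
      using D(3) k by (simp add: mr aC field_simps)
    moreover have "real k * (2 * real k - 1) \<noteq> 0" using k by auto
    ultimately show ?thesis
      by (simp add: eq_divide_eq power2_eq_square algebra_simps)
  qed
  moreover have "a = 1 - (2 * real k - 1) * b"
    using D(3) by (simp add: mr)
  ultimately show "\<exists>C>0. b = (real k - real C) / (2 * (real k)\<^sup>2 - real k) \<and>
      a = 1 - (2 * real k - 1) * b" by blast
qed

end
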